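(* Consider the explicit predictor/multicorrector generalized-$\alpha$ scheme with $N$ update terms and parameters $\alpha_m,\alpha_f,\beta,\gamma$ (defined in the context) for the semi-discrete hyperbolic system $\mathbb{M}\ddot{\mathbf U}+\mathbb{K}\mathbf U=\mathbf F(t)$, in its displacement-update or its acceleration-update form. We obtain a scheme with second-order accuracy in time by setting $$\gamma=\frac12-\alpha_f+\alpha_m .$$
   Context: **Setting.** The system comes from the spatial (Galerkin) discretization of the wave equation $\ddot u-\Delta u=f$ on a body $\mathcal B\subset\mathbb R^d$, with test functions $\Psi_i$ and trial functions $\Phi_j$. Here $\mathbb{M}$ is the (invertible) mass matrix, $\mathbb{M}_{ij}=\int_{\mathcal B}\Psi_i\Phi_j\,d\mathcal B$; $\mathbb{K}$ is the stiffness matrix, $\mathbb{K}_{ij}=\int_{\mathcal B}\nabla\Psi_i\cdot\nabla\Phi_j\,d\mathcal B$; and $\mathbf F(t)$ is the forcing vector, whose entries are the duality pairings $\langle\Psi_i,f(t)\rangle$. Let $\Delta t>0$ be the time step, $t_{n+1}=t_n+\Delta t$, $t_{n+\alpha_f}=t_n+\alpha_f\Delta t$, and $\mathbf F_{n+\alpha_f}=\mathbf F(t_{n+\alpha_f})$. The vectors $\mathbf U_n,\dot{\mathbf U}_n,\ddot{\mathbf U}_n$ are the unknowns of the scheme and approximate the solution and its first and second time derivatives at $t_n$. Write $[\![\bullet]\!]=\bullet_{n+1}-\bullet_n$. The numbers $\alpha_m,\alpha_f,\beta,\gamma$ are real parameters and $N$, a positive integer, is the number of terms in the update. Define the updating matrix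 $$\mathbb{U}=-\frac{\alpha_f\,\Delta t^2\,\beta}{\alpha_m}\,\mathbb{M}^{-1}\mathbb{K}.$$ **The scheme.** One time step determines $(\mathbf U_{n+1},\dot{\mathbf U}_{n+1},\ddot{\mathbf U}_{n+1})$ from $(\mathbf U_n,\dot{\mathbf U}_n,\ddot{\mathbf U}_n)$ by the relations $$[\![\mathbf U]\!]=\Delta t\Big(\dot{\mathbf U}_n+\Delta t\big(\tfrac12\ddot{\mathbf U}_n+\beta[\![\ddot{\mathbf U}]\!]\big)\Big),\qquad [\![\dot{\mathbf U}]\!]=\Delta t\big(\ddot{\mathbf U}_n+\gamma[\![\ddot{\mathbf U}]\!]\big),$$ together with one of the following explicit $N$-term updates. *Displacement-update form:* $$[\![\mathbf U]\!]=\Big[\sum_{j=0}^{N-1}\mathbb{U}^j\Big]\mathbf H,\qquad \mathbf H=\frac{\beta\Delta t^2}{\alpha_m}\mathbb{M}^{-1}\big(\mathbf F_{n+\alpha_f}-\mathbb{M}\ddot{\mathbf U}_n-\mathbb{K}\mathbf U_n\big)+\Delta t\,\dot{\mathbf U}_n+\frac{\Delta t^2}{2}\ddot{\mathbf U}_n .$$ *Acceleration-update form:* $$[\![\ddot{\mathbf U}]\!]=\Big[\sum_{j=0}^{N-1}\mathbb{U}^j\Big]\widehat{\mathbf H},\qquad \widehat{\mathbf H}=\frac{1}{\alpha_m}\mathbb{M}^{-1}\Big(\mathbf F_{n+\alpha_f}-\mathbb{M}\ddot{\mathbf U}_n-\mathbb{K}\mathbf U_n-\alpha_f\mathbb{K}\big(\Delta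 t\,\dot{\mathbf U}_n+\tfrac{\Delta t^2}{2}\ddot{\mathbf U}_n\big)\Big).$$ The accuracy analysis is carried out mode by mode, using the spectral decomposition of $\mathbb{M}^{-1}\mathbb{K}$ with eigenvalues $\omega_i^2$.
   Formalization: The displacement-update form with N = 1 is covered only when α_f = 0: for N = 1 and α_f ≠ 0 the stated γ gives only first order (e.g. M = K = 1, F = 0). Also α_m ≠ 0, and β ≠ 0 in displacement form, so that the scheme is defined. *)

theory Defs
  imports "HOL-Analysis.Analysis"
begin

datatype update_form = Displacement | Acceleration

record gen_alpha =
  upd_form :: update_form
  num_terms :: nat
  alpha_m :: real
  alpha_f :: real
  beta :: real
  gamma :: real

(* The power operator of the type class acts componentwise on real^'n^'n,
   so matrix powers are iterated matrix products. *)
definition mat_pow :: "real^'n^'n \<Rightarrow> nat \<Rightarrow> real^'n^'n" where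
  "mat_pow A j = (((**) A) ^^ j) (mat 1)"

definition updating_matrix ::
    "gen_alpha \<Rightarrow> real^'n^'n \<Rightarrow> real^'n^'n \<Rightarrow> real \<Rightarrow> real^'n^'n" where
  "updating_matrix s M K \<Delta>t =
     - ((alpha_f s * \<Delta>t\<^sup>2 * beta s / alpha_m s) *\<^sub>R (matrix_inv M ** K))"

definition update_sum ::
    "gen_alpha \<Rightarrow> real^'n^'n \<Rightarrow> real^'n^'n \<Rightarrow> real \<Rightarrow> real^'n^'n" where
  "update_sum s M K \<Delta>t = (\<Sum>j<num_terms s. mat_pow (updating_matrix s M K \<Delta>t) j)"

(* Displacement, velocity and acceleration at one time level. *)
type_synonym 'n state = "(real^'n) \<times> (real^'n) \<times> (real^'n)"

(* f is the forcing vector at the time t_n + alpha_f * \<Delta>t. *)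
fun gen_alpha_step ::
    "gen_alpha \<Rightarrow> real^'n^'n \<Rightarrow> real^'n^'n \<Rightarrow> real \<Rightarrow> real^'n \<Rightarrow> 'n state \<Rightarrow> 'n state \<Rightarrow> bool" where
  "gen_alpha_step s M K \<Delta>t f (U, V, A) (U', V', A') \<longleftrightarrow>
     U' - U = \<Delta>t *\<^sub>R (V + \<Delta>t *\<^sub>R ((1/2) *\<^sub>R A + beta s *\<^sub>R (A' - A))) \<and>
     V' - V = \<Delta>t *\<^sub>R (A + gamma s *\<^sub>R (A' - A)) \<and>
     (case upd_form s of
        Displacement \<Rightarrow>
          U' - U = update_sum s M K \<Delta>t *v
            ((beta s * \<Delta>t\<^sup>2 / alpha_m s) *\<^sub>R (matrix_inv M *v (f - M *v A - K *v U))
             + \<Delta>t *\<^sub>R V + (\<Delta>t\<^sup>2 / 2) *\<^sub>R A)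
      | Acceleration \<Rightarrow>
          A' - A = update_sum s M K \<Delta>t *v
            ((1 / alpha_m s) *\<^sub>R (matrix_inv M *v
               (f - M *v A - K *v U - alpha_f s *\<^sub>R (K *v (\<Delta>t *\<^sub>R V + (\<Delta>t\<^sup>2 / 2) *\<^sub>R A))))))"

(* The columns of Q are eigenvectors of P, the mode i having eigenvalue (\<omega> i)^2. *)
definition spectral_decomposition ::
    "real^'n^'n \<Rightarrow> real^'n^'n \<Rightarrow> ('n \<Rightarrow> real) \<Rightarrow> bool" where
  "spectral_decomposition P Q \<omega> \<longleftrightarrow>
     invertible Q \<and>
     P = Q ** (\<chi> i j. if i = j then (\<omega> i)\<^sup>2 else 0) ** matrix_inv Q"

definition modal_coord :: "real^'n^'n \<Rightarrow> 'n \<Rightarrow> real^'n \<Rightarrow> real" where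
  "modal_coord Q i x = (matrix_inv Q *v x) $ i"

(* Along the mode shape x, the unforced step acts on the modal amplitudes of
   displacement, velocity and acceleration as multiplication by G. *)
definition amplification_matrix ::
    "gen_alpha \<Rightarrow> real^'n^'n \<Rightarrow> real^'n^'n \<Rightarrow> real \<Rightarrow> real^'n \<Rightarrow> real^3^3 \<Rightarrow> bool" where
  "amplification_matrix s M K \<Delta>t x G \<longleftrightarrow>
     (\<forall>X Y :: real^3.
        gen_alpha_step s M K \<Delta>t 0
          (X$1 *\<^sub>R x, X$2 *\<^sub>R x, X$3 *\<^sub>R x) (Y$1 *\<^sub>R x, Y$2 *\<^sub>R x, Y$3 *\<^sub>R x)
        \<longleftrightarrow> Y = G *v X)"

definition principal_minors2 :: "real^3^3 \<Rightarrow> real" where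
  "principal_minors2 G =
     (G$1$1 * G$2$2 - G$1$2 * G$2$1) + (G$1$1 * G$3$3 - G$1$3 * G$3$1)
     + (G$2$2 * G$3$3 - G$2$3 * G$3$2)"

(* The coefficients are those of the characteristic polynomial of G, so that by
   Cayley-Hamilton every component x of a solution of X (k+1) = G X k is
   annihilated.  This is the three-step recurrence obtained by eliminating
   velocity and acceleration. *)
definition three_step :: "real^3^3 \<Rightarrow> (nat \<Rightarrow> real) \<Rightarrow> real" where
  "three_step G x = x 3 - trace G * x 2 + principal_minors2 G * x 1 - det G * x 0"

(* D k is the k-th time derivative of the exact solution D 0, which is r times
   continuously differentiable. *)
definition semidiscrete_solution ::
    "nat \<Rightarrow> real^'n^'n \<Rightarrow> real^'n^'n \<Rightarrow> (real \<Rightarrow> real^'n) \<Rightarrow> (nat \<Rightarrow> real \<Rightarrow> real^'n) \<Rightarrow> bool" where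
  "semidiscrete_solution r M K F D \<longleftrightarrow>
     (\<forall>k<r. \<forall>t. (D k has_vector_derivative D (Suc k) t) (at t)) \<and>
     continuous_on UNIV (D r) \<and>
     (\<forall>t. M *v D 2 t + K *v D 0 t = F t)"

(* Order p means that, in every mode and uniformly on bounded time intervals, the
   local truncation error of the three-step recurrence for the displacement is
   O(\<Delta>t^p).  With forcing, three_step applied to the displacements of a numerical
   solution X depends only on the three forcing values, not on X 0 (Cayley-Hamilton);
   subtracting it yields the residual of the exact displacements in the forced
   recurrence.  The division by \<Delta>t^2 normalises the recurrence so that it is
   consistent with the second-order differential equation. *)
definition time_accurate ::
    "nat \<Rightarrow> gen_alpha \<Rightarrow> real^'n^'n \<Rightarrow> real^'n^'n \<Rightarrow> real^'n^'n \<Rightarrow> bool" where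
  "time_accurate p s M K Q \<longleftrightarrow>
     (\<forall>\<Delta>t>0. \<forall>f X. \<exists>!Y. gen_alpha_step s M K \<Delta>t f X Y) \<and>
     (\<forall>F D T. semidiscrete_solution (p + 2) M K F D \<longrightarrow>
       (\<exists>C h. h > 0 \<and>
         (\<forall>i. \<forall>\<Delta>t. 0 < \<Delta>t \<and> \<Delta>t < h \<longrightarrow>
           (\<exists>G. amplification_matrix s M K \<Delta>t (column i Q) G \<and>
             (\<forall>t X. 0 \<le> t \<and> t \<le> T \<and>
               (\<forall>k<3. gen_alpha_step s M K \<Delta>t (F (t + real k * \<Delta>t + alpha_f s * \<Delta>t))
                         (X k) (X (Suc k))) \<longrightarrow>
               \<bar>three_step G (\<lambda>k. modal_coord Q i (D 0 (t + real k * \<Delta>t) - fst (X k)))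
                  / \<Delta>t\<^sup>2\<bar> \<le> C * \<Delta>t ^ p)))))"

end

theory Submission
  imports Defs "HOL-Library.Landau_Symbols"
begin

text \<open>
  The eigenvectors of $M^{-1}K$ turn the matrix sum of the update into a finite geometric series, so
  that the scheme decouples into scalar ones. Write $h$ for the time step, $\lambda = \omega_i^2$,
  $u, v, a$ for the modal displacement, velocity and acceleration, and $\phi$ for the modal load. In
  both forms, the acceleration increment is
  \[ d = p\,(\phi - a - \lambda u) - \alpha_f \lambda q\,(h v + \tfrac12 h^2 a) \]
  (\<open>gen_alpha_step_iff_modal\<close>). The forms differ in $q$ only: both have
  $p = \alpha_m^{-1} \sum_{j<N} \zeta^j$ with $\zeta = - \alpha_f \beta h^2 \lambda / \alpha_m$, while
  $q = p$ for the acceleration update and $q = \alpha_m^{-1} \sum_{j<N-1} \zeta^j$ for the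
  displacement update.

  The amplification matrix of a mode is a Taylor shift plus a matrix of rank one, which makes its
  characteristic polynomial explicit. In terms of the forward difference $\Delta$ over $h$, the
  displacements of a numerical solution satisfy
  \[ \Delta^3 u + (p + \lambda h^2 A)\,\Delta^2 u + \lambda h^2 B\,\Delta u + p \lambda h^2 u
     = p h^2 \bigl(\beta \Delta^2 + (\gamma + \tfrac12) \Delta + 1\bigr) \phi, \]
  where $A = p \beta + \alpha_f q (\gamma + \tfrac12)$ and $B = p (\gamma + \tfrac12) + \alpha_f q$
  (\<open>three_step_differences\<close>, \<open>three_step_forced\<close>). The local error is the residual of the exact
  solution $y$ in this recurrence, with $\phi = y'' + \lambda y$ evaluated at times shifted by
  $\alpha_f h$. The terms of order $h^2$ cancel by the differential equation, and those of order
  $h^3$ are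
  \[ h^3 \bigl(1 + p\,(\tfrac12 - \gamma - \alpha_f)\bigr)\, y'''
     + h^3 \lambda \alpha_f (q - p)\, y'. \]
  For $\gamma = \tfrac12 - \alpha_f + \alpha_m$ the first coefficient is $1 - p \alpha_m = O(h^2)$.
  In the second, $\alpha_f (q - p) = O(h^2)$ (\<open>weights_agree\<close>): for the displacement update this needs
  $q$ to contain at least one term of the series, that is $N \ge 2$, unless $\alpha_f = 0$. The residual
  is thus $O(h^4)$ (\<open>modal_truncation\<close>), and the normalisation of the recurrence by $h^2$ leaves
  $O(h^2)$.
\<close>

section \<open>The scheme for a single mode\<close>

text \<open>
  The eigenvalue of the truncated Neumann series on a mode with eigenvalue \<open>l\<close> of $M^{-1}K$. The number
  of terms is a parameter because the displacement update leads to series of two lengths.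
\<close>
definition geometric_factor :: "gen_alpha \<Rightarrow> real \<Rightarrow> real \<Rightarrow> nat \<Rightarrow> real" where
  "geometric_factor s l h n = (\<Sum>j<n. (- (alpha_f s * h\<^sup>2 * beta s / alpha_m s * l)) ^ j)"

definition load_weight :: "gen_alpha \<Rightarrow> real \<Rightarrow> real \<Rightarrow> real" where
  "load_weight s l h = geometric_factor s l h (num_terms s) / alpha_m s"

text \<open>
  The weight with which the predictor $h v + \tfrac12 h^2 a$ enters the acceleration increment. The
  displacement update applies the whole series to the predictor, of which the displacement increment
  contains one copy itself. The difference is the series without its first term, that is
  $- \alpha_f \beta h^2 \lambda / \alpha_m$ times the series with one term less.
\<close>
definition predictor_weight :: "gen_alpha \<Rightarrow> real \<Rightarrow> real \<Rightarrow> real" where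
  "predictor_weight s l h =
     (case upd_form s of
        Displacement \<Rightarrow> geometric_factor s l h (num_terms s - 1) / alpha_m s
      | Acceleration \<Rightarrow> geometric_factor s l h (num_terms s) / alpha_m s)"

fun modal_increment :: "gen_alpha \<Rightarrow> real \<Rightarrow> real \<Rightarrow> real \<Rightarrow> real \<times> real \<times> real \<Rightarrow> real" where
  "modal_increment s l h \<phi> (u, v, a) =
     load_weight s l h * (\<phi> - a - l * u)
     - alpha_f s * l * predictor_weight s l h * (h * v + h\<^sup>2 / 2 * a)"

fun modal_step ::
    "gen_alpha \<Rightarrow> real \<Rightarrow> real \<Rightarrow> real \<Rightarrow> real \<times> real \<times> real \<Rightarrow> real \<times> real \<times> real" where
  "modal_step s l h \<phi> (u, v, a) =
     (let d = modal_increment s l h \<phi> (u, v, a) in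
       (u + h * v + h\<^sup>2 / 2 * a + beta s * h\<^sup>2 * d, v + h * a + gamma s * h * d, a + d))"

text \<open>
  The shift by one time step of a quadratic Taylor polynomial, plus the product of the column
  $(\beta h^2, \gamma h, 1)$ with the row \<open>(r1, r2, r3)\<close> which expresses the acceleration increment of the
  unforced mode through its state.
\<close>
definition modal_matrix :: "gen_alpha \<Rightarrow> real \<Rightarrow> real \<Rightarrow> real^3^3" where
  "modal_matrix s l h =
     (let p = load_weight s l h; q = alpha_f s * l * predictor_weight s l h;
          r1 = - (p * l); r2 = - (q * h); r3 = - (p + q * h\<^sup>2 / 2);
          b = beta s * h\<^sup>2; c = gamma s * h
      in vector [vector [1 + b * r1, h + b * r2, h\<^sup>2 / 2 + b * r3],
                 vector [c * r1, 1 + c * r2, h + c * r3],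
                 vector [r1, r2, 1 + r3]])"

lemma modal_matrix_step:
  "modal_step s l h 0 (x $ 1, x $ 2, x $ 3)
   = ((modal_matrix s l h *v x) $ 1, (modal_matrix s l h *v x) $ 2, (modal_matrix s l h *v x) $ 3)"
  by (simp add: modal_matrix_def Let_def matrix_vector_mult_def sum_3 algebra_simps)

text \<open>
  Since the Taylor shift is unipotent, the characteristic polynomial is simplest in powers of $z - 1$.
  This turns the three-step recurrence into one in forward differences, whose orders in \<open>h\<close> are
  visible term by term.
\<close>
lemma three_step_differences:
  fixes s :: gen_alpha and l h :: real
  defines "p \<equiv> load_weight s l h" and "q \<equiv> alpha_f s * predictor_weight s l h"
  shows "three_step (modal_matrix s l h) x =
     (x 3 - 3 * x 2 + 3 * x 1 - x 0)
     + (p + l * h\<^sup>2 * (p * beta s + q * (gamma s + 1/2))) * (x 2 - 2 * x 1 + x 0)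
     + l * h\<^sup>2 * (p * (gamma s + 1/2) + q) * (x 1 - x 0)
     + p * l * h\<^sup>2 * x 0"
  unfolding three_step_def principal_minors2_def det_3 trace_def sum_3 modal_matrix_def Let_def vector_3 p_def q_def
  by (simp add: field_simps power2_eq_square)

text \<open>
  The homogeneous part of a numerical solution is annihilated by Cayley-Hamilton. The loads
  enter along the same column $c = (\beta h^2, \gamma h, 1)$ as the rank-one part of the amplification
  matrix $G$, and adding a matrix of the form $c r^T$ to $G$ does not affect
  $\mathrm{adj}(z - G)\, c$. The coefficients on the right are therefore those of the plain Taylor
  shift, and the eigenvalue enters through the weight only.
\<close>
lemma three_step_forced:
  assumes "\<And>k. k < 3 \<Longrightarrow> (u (Suc k), v (Suc k), a (Suc k)) = modal_step s l h (\<phi> k) (u k, v k, a k)"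
  shows "three_step (modal_matrix s l h) u =
     load_weight s l h * h\<^sup>2 *
       (beta s * (\<phi> 2 - 2 * \<phi> 1 + \<phi> 0) + (gamma s + 1/2) * (\<phi> 1 - \<phi> 0) + \<phi> 0)"
proof -
  define d where "d k = modal_increment s l h (\<phi> k) (u k, v k, a k)" for k
  have step: "u (Suc k) = u k + h * v k + h\<^sup>2 / 2 * a k + beta s * h\<^sup>2 * d k"
    "v (Suc k) = v k + h * a k + gamma s * h * d k" "a (Suc k) = a k + d k" if "k < 3" for k
    using assms[OF that] by (simp_all add: Let_def d_def)
  note s0 = step[of 0, simplified] and s1 = step[of 1, simplified] and s2 = step[of 2, simplified]
  have e: "d k = load_weight s l h * (\<phi> k - a k - l * u k)
     - alpha_f s * l * predictor_weight s l h * (h * v k + h\<^sup>2 / 2 * a k)" for k by (simp add: d_def)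
  \<comment> \<open>The loads are eliminated in favour of the increments, which then play the role of independent unknowns.\<close>
  have d1: "load_weight s l h * \<phi> k = d k + load_weight s l h * (a k + l * u k)
     + alpha_f s * l * predictor_weight s l h * (h * v k + h\<^sup>2 / 2 * a k)" for k
    using e[of k] by (simp add: algebra_simps)
  have r: "load_weight s l h * h\<^sup>2 *
       (beta s * (\<phi> 2 - 2 * \<phi> 1 + \<phi> 0) + (gamma s + 1/2) * (\<phi> 1 - \<phi> 0) + \<phi> 0)
    = h\<^sup>2 * (beta s * (load_weight s l h * \<phi> 2 - 2 * (load_weight s l h * \<phi> 1) + load_weight s l h * \<phi> 0)
     + (gamma s + 1/2) * (load_weight s l h * \<phi> 1 - load_weight s l h * \<phi> 0) + load_weight s l h * \<phi> 0)"
    by (simp add: algebra_simps)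
  show ?thesis unfolding r d1 three_step_differences
    using s0 s1 s2
    by (simp add: numeral_2_eq_2 numeral_3_eq_3) (simp add: field_simps power2_eq_square)
qed

lemma three_step_diff: "three_step G (\<lambda>k. x k - z k) = three_step G x - three_step G z"
  by (simp add: three_step_def algebra_simps)

section \<open>Decoupling into modes\<close>

text \<open>
  A separated first term is what links the two lengths of the series in the displacement update.
\<close>
lemma geometric_factor_Suc:
  "geometric_factor s l h (Suc n) =
     1 - alpha_f s * h\<^sup>2 * beta s / alpha_m s * l * geometric_factor s l h n"
  unfolding geometric_factor_def
  by (subst sum.lessThan_Suc_shift) (simp add: sum_distrib_left sum_negf mult.assoc)

lemma matrix_inv_inverse:
  fixes A :: "real^'n^'n"
  assumes "invertible A"
  shows "A ** matrix_inv A = mat 1" "matrix_inv A ** A = mat 1"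
proof -
  have "A ** matrix_inv A = mat 1 \<and> matrix_inv A ** A = mat 1"
    using assms unfolding invertible_def matrix_inv_def by (rule someI_ex)
  then show "A ** matrix_inv A = mat 1" "matrix_inv A ** A = mat 1" by auto
qed

lemma linear_modal_coord: "linear (modal_coord Q i)"
  unfolding modal_coord_def
  by (rule linearI) (simp_all add: matrix_vector_right_distrib matrix_vector_mult_scaleR)

lemmas modal_coord_simps =
  linear_add[OF linear_modal_coord] linear_diff[OF linear_modal_coord]
  linear_cmul[OF linear_modal_coord]

lemma modal_coord_synthesis:
  assumes "invertible Q"
  shows "modal_coord Q i (Q *v w) = w $ i"
  by (simp add: modal_coord_def matrix_vector_mul_assoc matrix_inv_inverse[OF assms])

lemma modal_coord_eqI:
  assumes "invertible Q" "\<And>i. modal_coord Q i x = modal_coord Q i y"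
  shows "x = y"
proof -
  have "matrix_inv Q *v x = matrix_inv Q *v y"
    using assms(2) by (simp add: modal_coord_def vec_eq_iff)
  then have "Q *v (matrix_inv Q *v x) = Q *v (matrix_inv Q *v y)" by simp
  then show ?thesis by (simp add: matrix_vector_mul_assoc matrix_inv_inverse[OF assms(1)])
qed

lemma modal_coord_column:
  assumes "invertible Q"
  shows "modal_coord Q i (column j Q) = (if i = j then 1 else 0)"
  using modal_coord_synthesis[OF assms, of i "axis j 1"]
  by (simp add: matrix_vector_mult_basis) (simp add: axis_def)

lemma modal_coord_eigen:
  fixes P Q :: "real^'n^'n"
  assumes "spectral_decomposition P Q \<omega>"
  shows "modal_coord Q i (P *v x) = (\<omega> i)\<^sup>2 * modal_coord Q i x"
proof -
  define L :: "real^'n^'n" where "L = (\<chi> i j. if i = j then (\<omega> i)\<^sup>2 else 0)"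
  have Q: "invertible Q" and P: "P = Q ** L ** matrix_inv Q"
    using assms unfolding spectral_decomposition_def L_def by auto
  have "P *v x = Q *v (L *v (matrix_inv Q *v x))"
    by (simp add: P matrix_vector_mul_assoc matrix_mul_assoc)
  then have "modal_coord Q i (P *v x) = (L *v (matrix_inv Q *v x)) $ i"
    by (simp add: modal_coord_synthesis[OF Q])
  also have "\<dots> = (\<omega> i)\<^sup>2 * modal_coord Q i x"
    by (simp add: L_def matrix_vector_mult_def[of L] matrix_vector_mult_def[of "\<chi> i j. _ i j"]
        modal_coord_def if_distrib[of "\<lambda>c. c * _"] cong: if_cong)
  finally show ?thesis .
qed

lemma modal_coord_mat_pow:
  assumes "\<And>x. modal_coord Q i (A *v x) = c * modal_coord Q i x"
  shows "modal_coord Q i (mat_pow A j *v x) = c ^ j * modal_coord Q i x"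
proof (induction j)
  case 0
  then show ?case by (simp add: mat_pow_def)
next
  case (Suc j)
  have "mat_pow A (Suc j) *v x = A *v (mat_pow A j *v x)"
    by (simp add: mat_pow_def matrix_vector_mul_assoc)
  then show ?case using Suc assms by simp
qed

text \<open>
  The updating matrix is a multiple of $M^{-1}K$, so a mode is an eigenvector of all its powers.
\<close>
lemma modal_coord_update_sum:
  assumes "spectral_decomposition (matrix_inv M ** K) Q \<omega>"
  shows "modal_coord Q i (update_sum s M K h *v x) =
     geometric_factor s ((\<omega> i)\<^sup>2) h (num_terms s) * modal_coord Q i x"
proof -
  define c where "c = - (alpha_f s * h\<^sup>2 * beta s / alpha_m s * (\<omega> i)\<^sup>2)"
  have "modal_coord Q i (updating_matrix s M K h *v z) = c * modal_coord Q i z" for z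
  proof -
    have "updating_matrix s M K h *v z =
        - (alpha_f s * h\<^sup>2 * beta s / alpha_m s) *\<^sub>R ((matrix_inv M ** K) *v z)"
      unfolding updating_matrix_def
      by (metis scaleR_matrix_vector_assoc scaleR_minus_left)
    then show ?thesis
      by (simp only: modal_coord_simps modal_coord_eigen[OF assms]) (simp add: c_def)
  qed
  from modal_coord_mat_pow[of Q i, OF this]
  have pow: "modal_coord Q i (mat_pow (updating_matrix s M K h) j *v x) = c ^ j * modal_coord Q i x" for j .
  have "modal_coord Q i ((\<Sum>j<n. mat_pow (updating_matrix s M K h) j) *v x) =
      (\<Sum>j<n. c ^ j) * modal_coord Q i x" for n
  proof (induction n)
    case 0
    then show ?case using linear_0[OF linear_modal_coord] by simp
  next
    case (Suc n)
    then show ?case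
      by (simp add: matrix_vector_mult_add_rdistrib modal_coord_simps pow algebra_simps)
  qed
  then show ?thesis by (simp add: update_sum_def geometric_factor_def c_def)
qed

fun modal_state :: "real^'n^'n \<Rightarrow> 'n \<Rightarrow> 'n state \<Rightarrow> real \<times> real \<times> real" where
  "modal_state Q i (U, V, A) = (modal_coord Q i U, modal_coord Q i V, modal_coord Q i A)"

text \<open>
  In modal coordinates the relations of the scheme determine the new state explicitly. For the
  acceleration update the increment can be read off. For the displacement update it has to be
  recovered from the displacement, by cancelling $\beta h^2$; this is where $\beta \neq 0$ enters.
\<close>
lemma gen_alpha_step_iff_modal:
  assumes M: "invertible M" and spec: "spectral_decomposition (matrix_inv M ** K) Q \<omega>"
    and N: "num_terms s \<ge> 1" and am: "alpha_m s \<noteq> 0"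
    and b: "upd_form s = Displacement \<Longrightarrow> beta s \<noteq> 0" and h: "h > 0"
  shows "gen_alpha_step s M K h f X X' \<longleftrightarrow>
     (\<forall>i. modal_state Q i X' =
        modal_step s ((\<omega> i)\<^sup>2) h (modal_coord Q i (matrix_inv M *v f)) (modal_state Q i X))"
proof -
  obtain U V A where X: "X = (U, V, A)" by (cases X)
  obtain U' V' A' where X': "X' = (U', V', A')" by (cases X')
  have Q: "invertible Q" using spec by (simp add: spectral_decomposition_def)
  let ?c = "modal_coord Q"
  have iff: "x = y \<longleftrightarrow> (\<forall>i. ?c i x = ?c i y)" for x y
    using modal_coord_eqI[OF Q] by auto
  have MK: "matrix_inv M *v (M *v x) = x" "matrix_inv M *v (K *v x) = (matrix_inv M ** K) *v x" for x
    by (simp_all add: matrix_vector_mul_assoc matrix_inv_inverse[OF M])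
  obtain n where n: "num_terms s = Suc n" using N by (cases "num_terms s") auto
  have mode: "?c i U' - ?c i U = h * (?c i V + h * (1/2 * ?c i A + beta s * (?c i A' - ?c i A))) \<and>
      ?c i V' - ?c i V = h * (?c i A + gamma s * (?c i A' - ?c i A)) \<and>
      (case upd_form s of
        Displacement \<Rightarrow> ?c i U' - ?c i U = geometric_factor s ((\<omega> i)\<^sup>2) h (num_terms s) *
          (beta s * h\<^sup>2 / alpha_m s * (?c i (matrix_inv M *v f) - ?c i A - (\<omega> i)\<^sup>2 * ?c i U)
             + h * ?c i V + h\<^sup>2 / 2 * ?c i A)
      | Acceleration \<Rightarrow> ?c i A' - ?c i A = geometric_factor s ((\<omega> i)\<^sup>2) h (num_terms s) *
          (1 / alpha_m s * (?c i (matrix_inv M *v f) - ?c i A - (\<omega> i)\<^sup>2 * ?c i U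
             - alpha_f s * ((\<omega> i)\<^sup>2 * (h * ?c i V + h\<^sup>2 / 2 * ?c i A)))))
    \<longleftrightarrow> modal_state Q i X' =
        modal_step s ((\<omega> i)\<^sup>2) h (?c i (matrix_inv M *v f)) (modal_state Q i X)" (is "?L i \<longleftrightarrow> ?R i") for i
  proof -
    define l where "l = (\<omega> i)\<^sup>2"
    define g where "g = geometric_factor s l h n"
    define \<phi> where "\<phi> = ?c i (matrix_inv M *v f)"
    obtain u v a u' v' a' where uv: "?c i U = u" "?c i V = v" "?c i A = a"
      "?c i U' = u'" "?c i V' = v'" "?c i A' = a'" by blast
    define d where "d = modal_increment s l h \<phi> (u, v, a)"
    have R: "?R i \<longleftrightarrow> u' = u + h * v + h\<^sup>2 / 2 * a + beta s * h\<^sup>2 * d \<and> v' = v + h * a + gamma s * h * d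
        \<and> a' = a + d"
      by (simp add: X X' uv Let_def d_def l_def \<phi>_def)
    have disp: "u' - u = h * (v + h * (1/2 * a + beta s * (a' - a))) \<longleftrightarrow>
        u' = u + h * v + h\<^sup>2 / 2 * a + beta s * h\<^sup>2 * (a' - a)"
      by (simp add: diff_eq_eq power2_eq_square algebra_simps)
    have vel: "v' - v = h * (a + gamma s * (a' - a)) \<longleftrightarrow> v' = v + h * a + gamma s * h * (a' - a)"
      by (simp add: diff_eq_eq algebra_simps)
    show ?thesis
    proof (cases "upd_form s")
      case Acceleration
      have inc: "geometric_factor s l h (num_terms s) *
          (1 / alpha_m s * (\<phi> - a - l * u - alpha_f s * (l * (h * v + h\<^sup>2 / 2 * a)))) = d"
        using am by (simp add: d_def load_weight_def predictor_weight_def Acceleration field_simps)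
      show ?thesis
        unfolding R unfolding uv disp vel l_def[symmetric] \<phi>_def[symmetric] Acceleration update_form.case inc
        by (rule iffI; elim conjE; simp add: diff_eq_eq add.commute)
    next
      case Displacement
      have inc: "geometric_factor s l h (num_terms s) *
          (beta s * h\<^sup>2 / alpha_m s * (\<phi> - a - l * u) + h * v + h\<^sup>2 / 2 * a)
        = h * v + h\<^sup>2 / 2 * a + beta s * h\<^sup>2 * d"
        using am by (simp add: d_def load_weight_def predictor_weight_def Displacement n
            geometric_factor_Suc field_simps)
      have "beta s * h\<^sup>2 \<noteq> 0" using b[OF Displacement] h by simp
      moreover have "beta s * h\<^sup>2 * (a' - a) = beta s * h\<^sup>2 * d"
        if "u' = u + h * v + h\<^sup>2 / 2 * a + beta s * h\<^sup>2 * (a' - a)"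
          and "u' - u = h * v + h\<^sup>2 / 2 * a + beta s * h\<^sup>2 * d"
        using that by linarith
      ultimately have acc: "a' = a + d"
        if "u' = u + h * v + h\<^sup>2 / 2 * a + beta s * h\<^sup>2 * (a' - a)"
          and "u' - u = h * v + h\<^sup>2 / 2 * a + beta s * h\<^sup>2 * d"
        using that by (metis mult_left_cancel add_diff_cancel_left' add.commute diff_add_cancel)
      show ?thesis
        unfolding R unfolding uv disp vel l_def[symmetric] \<phi>_def[symmetric] Displacement update_form.case inc
      proof (intro iffI; elim conjE)
        assume u: "u' = u + h * v + h\<^sup>2 / 2 * a + beta s * h\<^sup>2 * (a' - a)"
          and "v' = v + h * a + gamma s * h * (a' - a)"
          and "u' - u = h * v + h\<^sup>2 / 2 * a + beta s * h\<^sup>2 * d"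
        then show "u' = u + h * v + h\<^sup>2 / 2 * a + beta s * h\<^sup>2 * d \<and> v' = v + h * a + gamma s * h * d
            \<and> a' = a + d"
          using acc by simp
      qed simp
    qed
  qed
  have "gen_alpha_step s M K h f X X' \<longleftrightarrow> (\<forall>i. ?L i)"
    unfolding X X' gen_alpha_step.simps iff
    by (cases "upd_form s")
      (auto simp: modal_coord_simps modal_coord_update_sum[OF spec] modal_coord_eigen[OF spec]
        matrix_vector_mult_diff_distrib matrix_vector_mult_scaleR MK right_diff_distrib mult_ac)
  then show ?thesis by (simp only: mode)
qed

text \<open>
  The modal steps are functions, and a vector is freely prescribed by its modal coordinates.
\<close>
lemma gen_alpha_step_unique:
  assumes "invertible M" "spectral_decomposition (matrix_inv M ** K) Q \<omega>"
    "num_terms s \<ge> 1" "alpha_m s \<noteq> 0" "upd_form s = Displacement \<Longrightarrow> beta s \<noteq> 0" "h > 0"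
  shows "\<exists>!Y. gen_alpha_step s M K h f X Y"
proof -
  have Q: "invertible Q" using assms(2) by (simp add: spectral_decomposition_def)
  define z where "z i = modal_step s ((\<omega> i)\<^sup>2) h (modal_coord Q i (matrix_inv M *v f)) (modal_state Q i X)" for i
  have iff: "gen_alpha_step s M K h f X Y \<longleftrightarrow> (\<forall>i. modal_state Q i Y = z i)" for Y
    unfolding z_def by (rule gen_alpha_step_iff_modal) (use assms in auto)
  show ?thesis
  proof (rule ex1I)
    show "gen_alpha_step s M K h f X
        (Q *v (\<chi> i. fst (z i)), Q *v (\<chi> i. fst (snd (z i))), Q *v (\<chi> i. snd (snd (z i))))"
      unfolding iff by (simp add: modal_coord_synthesis[OF Q])
  next
    fix Y assume Y: "gen_alpha_step s M K h f X Y"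
    obtain U V A where "Y = (U, V, A)" by (cases Y)
    moreover from this Y have "modal_coord Q i U = fst (z i) \<and> modal_coord Q i V = fst (snd (z i)) \<and>
        modal_coord Q i A = snd (snd (z i))" for i
      unfolding iff by (metis fst_conv snd_conv modal_state.simps)
    ultimately show "Y = (Q *v (\<chi> i. fst (z i)), Q *v (\<chi> i. fst (snd (z i))), Q *v (\<chi> i. snd (snd (z i))))"
      by (auto intro!: modal_coord_eqI[OF Q] simp: modal_coord_synthesis[OF Q])
  qed
qed

text \<open>
  A state along one mode shape has zero coordinates in all other modes, where the unforced step
  maps zero to zero.
\<close>
lemma modal_matrix_is_amplification:
  assumes "invertible M" and spec: "spectral_decomposition (matrix_inv M ** K) Q \<omega>"
    and "num_terms s \<ge> 1" "alpha_m s \<noteq> 0" "upd_form s = Displacement \<Longrightarrow> beta s \<noteq> 0" "h > 0"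
  shows "amplification_matrix s M K h (column i Q) (modal_matrix s ((\<omega> i)\<^sup>2) h)"
  unfolding amplification_matrix_def
proof (intro allI)
  fix X Y :: "real^3"
  have Q: "invertible Q" using spec by (simp add: spectral_decomposition_def)
  let ?q = "column i Q"
  have state: "modal_state Q j (Z $ 1 *\<^sub>R ?q, Z $ 2 *\<^sub>R ?q, Z $ 3 *\<^sub>R ?q) =
      (if j = i then (Z $ 1, Z $ 2, Z $ 3) else (0, 0, 0))" for j and Z :: "real^3"
    by (simp add: modal_coord_simps modal_coord_column[OF Q])
  have "gen_alpha_step s M K h 0 (X$1 *\<^sub>R ?q, X$2 *\<^sub>R ?q, X$3 *\<^sub>R ?q) (Y$1 *\<^sub>R ?q, Y$2 *\<^sub>R ?q, Y$3 *\<^sub>R ?q)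
    \<longleftrightarrow> (\<forall>j. modal_state Q j (Y$1 *\<^sub>R ?q, Y$2 *\<^sub>R ?q, Y$3 *\<^sub>R ?q) =
          modal_step s ((\<omega> j)\<^sup>2) h 0 (modal_state Q j (X$1 *\<^sub>R ?q, X$2 *\<^sub>R ?q, X$3 *\<^sub>R ?q)))"
    by (subst gen_alpha_step_iff_modal[OF assms(1-6)]) (simp_all add: linear_0[OF linear_modal_coord])
  also have "\<dots> \<longleftrightarrow> (Y$1, Y$2, Y$3) = modal_step s ((\<omega> i)\<^sup>2) h 0 (X$1, X$2, X$3)"
    unfolding state by (auto simp: Let_def)
  also have "\<dots> \<longleftrightarrow> Y = modal_matrix s ((\<omega> i)\<^sup>2) h *v X"
    unfolding modal_matrix_step by (auto simp: vec_eq_iff forall_3)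
  finally show "gen_alpha_step s M K h 0 (X$1 *\<^sub>R ?q, X$2 *\<^sub>R ?q, X$3 *\<^sub>R ?q) (Y$1 *\<^sub>R ?q, Y$2 *\<^sub>R ?q, Y$3 *\<^sub>R ?q)
    \<longleftrightarrow> Y = modal_matrix s ((\<omega> i)\<^sup>2) h *v X" .
qed

section \<open>Orders in the time step, uniformly in time\<close>

text \<open>
  Landau symbols for error terms depending on an initial time \<open>t\<close> and a step \<open>h\<close>. The principal
  filter on the rectangle asks for one constant for all \<open>t\<close> in the time interval and all steps below 1,
  which is the uniformity required of the local error.
\<close>
definition uniform_bigo :: "real \<Rightarrow> nat \<Rightarrow> (real \<Rightarrow> real \<Rightarrow> real) \<Rightarrow> bool" where
  "uniform_bigo T k f \<longleftrightarrow>
     (\<lambda>(t, h). f t h) \<in> O[principal ({0..T} \<times> {0<..<1})](\<lambda>(t, h). h ^ k)"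

lemma uniform_bigoI:
  assumes "\<And>t h. 0 \<le> t \<Longrightarrow> t \<le> T \<Longrightarrow> 0 < h \<Longrightarrow> h < 1 \<Longrightarrow> \<bar>f t h\<bar> \<le> C * h ^ k"
  shows "uniform_bigo T k f"
  unfolding uniform_bigo_def
  by (rule bigoI[of _ C]) (auto simp: eventually_principal assms)

lemma uniform_bigoE:
  assumes "uniform_bigo T k f"
  obtains C where "C > 0"
    "\<And>t h. 0 \<le> t \<Longrightarrow> t \<le> T \<Longrightarrow> 0 < h \<Longrightarrow> h < 1 \<Longrightarrow> \<bar>f t h\<bar> \<le> C * h ^ k"
  using assms unfolding uniform_bigo_def
  by (elim landau_o.bigE) (auto simp: eventually_principal)

lemma uniform_bigo_add:
  "uniform_bigo T k f \<Longrightarrow> uniform_bigo T k g \<Longrightarrow> uniform_bigo T k (\<lambda>t h. f t h + g t h)"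
  unfolding uniform_bigo_def case_prod_unfold by (rule sum_in_bigo)

lemma uniform_bigo_diff:
  "uniform_bigo T k f \<Longrightarrow> uniform_bigo T k g \<Longrightarrow> uniform_bigo T k (\<lambda>t h. f t h - g t h)"
  unfolding uniform_bigo_def case_prod_unfold by (rule sum_in_bigo)

lemma uniform_bigo_mult:
  "uniform_bigo T j f \<Longrightarrow> uniform_bigo T k g \<Longrightarrow> uniform_bigo T (j + k) (\<lambda>t h. f t h * g t h)"
  unfolding uniform_bigo_def case_prod_unfold power_add by (rule landau_o.big.mult)

lemma uniform_bigo_bounded:
  assumes "uniform_bigo T 0 f" "uniform_bigo T k g"
  shows "uniform_bigo T k (\<lambda>t h. f t h * g t h)"
  using uniform_bigo_mult[OF assms] by simp

lemma uniform_bigo_weaken: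
  assumes "uniform_bigo T k f" "j \<le> k"
  shows "uniform_bigo T j f"
proof -
  obtain C where C: "C > 0"
    "\<And>t h. 0 \<le> t \<Longrightarrow> t \<le> T \<Longrightarrow> 0 < h \<Longrightarrow> h < 1 \<Longrightarrow> \<bar>f t h\<bar> \<le> C * h ^ k"
    using uniform_bigoE[OF assms(1)] by blast
  show ?thesis
  proof (rule uniform_bigoI)
    fix t h :: real assume "0 \<le> t" "t \<le> T" and h: "0 < h" "h < 1"
    then have "\<bar>f t h\<bar> \<le> C * h ^ k" using C by blast
    also have "\<dots> \<le> C * h ^ j"
      using power_decreasing[OF assms(2), of h] C(1) h by simp
    finally show "\<bar>f t h\<bar> \<le> C * h ^ j" .
  qed
qed

lemma uniform_bigo_const: "uniform_bigo T 0 (\<lambda>t h. c)"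
  by (rule uniform_bigoI[of _ _ "\<bar>c\<bar>"]) simp

lemma uniform_bigo_power: "uniform_bigo T k (\<lambda>t h. h ^ k)"
  by (rule uniform_bigoI[of _ _ 1]) simp

lemma uniform_bigo_continuous:
  assumes "continuous_on UNIV f"
  shows "uniform_bigo T 0 (\<lambda>t h. f t)"
proof -
  have "bounded (f ` {0..T})"
    using assms compact_continuous_image compact_imp_bounded compact_Icc continuous_on_subset subset_UNIV
    by metis
  then obtain B where "\<And>t. t \<in> {0..T} \<Longrightarrow> \<bar>f t\<bar> \<le> B"
    unfolding bounded_iff by (metis imageI real_norm_def)
  then show ?thesis by (intro uniform_bigoI[of _ _ B]) auto
qed

text \<open>
  The highest derivative is bounded on a compact interval that contains all intermediate points of
  the Lagrange remainder for steps below 1. The offset \<open>\<theta>\<close> may be negative, as happens at the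
  evaluation times of the load when $\alpha_f < 0$.
\<close>
lemma uniform_taylor_remainder:
  fixes f :: "nat \<Rightarrow> real \<Rightarrow> real"
  assumes deriv: "\<And>m t. m < n \<Longrightarrow> (f m has_real_derivative f (Suc m) t) (at t)"
    and cont: "continuous_on UNIV (f n)"
  shows "uniform_bigo T n (\<lambda>t h. f 0 (t + \<theta> * h) - (\<Sum>m<n. f m t / fact m * (\<theta> * h) ^ m))"
proof -
  have "bounded (f n ` {- \<bar>\<theta>\<bar>..T + \<bar>\<theta>\<bar>})"
    using cont compact_continuous_image compact_imp_bounded compact_Icc continuous_on_subset subset_UNIV
    by metis
  then obtain B where B: "\<And>x. - \<bar>\<theta>\<bar> \<le> x \<Longrightarrow> x \<le> T + \<bar>\<theta>\<bar> \<Longrightarrow> \<bar>f n x\<bar> \<le> B"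
    unfolding bounded_iff by (metis atLeastAtMost_iff imageI real_norm_def)
  show ?thesis
  proof (rule uniform_bigoI[of _ _ "B / fact n * \<bar>\<theta>\<bar> ^ n"])
    fix t h :: real assume t: "0 \<le> t" "t \<le> T" and h: "0 < h" "h < 1"
    have small: "\<bar>\<theta> * h\<bar> \<le> \<bar>\<theta>\<bar>"
      using h by (simp add: abs_mult mult_left_le)
    \<comment> \<open>The Lagrange form needs two distinct points and at least one derivative; the excluded
      cases are trivial.\<close>
    have "\<exists>x. \<bar>x - t\<bar> \<le> \<bar>\<theta> * h\<bar> \<and>
      f 0 (t + \<theta> * h) = (\<Sum>m<n. f m t / fact m * (\<theta> * h) ^ m) + f n x / fact n * (\<theta> * h) ^ n"
    proof (cases "n = 0 \<or> \<theta> * h = 0")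
      case True
      then show ?thesis
      proof (cases "n = 0")
        case True
        then show ?thesis by (intro exI[of _ "t + \<theta> * h"]) simp
      next
        case False
        then have "(\<Sum>m<n. f m t / fact m * 0 ^ m) = f 0 t"
          by (subst sum.mono_neutral_right[of _ "{0}"]) auto
        with False \<open>n = 0 \<or> \<theta> * h = 0\<close> show ?thesis by (intro exI[of _ t]) auto
      qed
    next
      case False
      show ?thesis
        using Taylor[of n f "f 0" "min t (t + \<theta> * h)" "max t (t + \<theta> * h)" t "t + \<theta> * h"] False deriv
        by (auto split: if_splits) (smt (verit))+
    qed
    then obtain x where x: "\<bar>x - t\<bar> \<le> \<bar>\<theta> * h\<bar>" and
      eq: "f 0 (t + \<theta> * h) = (\<Sum>m<n. f m t / fact m * (\<theta> * h) ^ m) + f n x / fact n * (\<theta> * h) ^ n"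
      by blast
    have "\<bar>f n x\<bar> \<le> B" using B x t small by auto
    then have "\<bar>f n x\<bar> / fact n * (\<bar>\<theta>\<bar> ^ n * h ^ n) \<le> B / fact n * (\<bar>\<theta>\<bar> ^ n * h ^ n)"
      using h by (intro mult_right_mono divide_right_mono) auto
    then show "\<bar>f 0 (t + \<theta> * h) - (\<Sum>m<n. f m t / fact m * (\<theta> * h) ^ m)\<bar> \<le> B / fact n * \<bar>\<theta>\<bar> ^ n * h ^ n"
      unfolding eq using h by (simp add: abs_mult power_abs power_mult_distrib mult.assoc)
  qed
qed

section \<open>Truncation error of a single mode\<close>

lemma geometric_factor_bounded: "uniform_bigo T 0 (\<lambda>t h. geometric_factor s l h n)"
proof (induction n)
  case 0
  then show ?case by (simp add: geometric_factor_def uniform_bigo_const)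
next
  case (Suc n)
  have "uniform_bigo T 0 (\<lambda>t h. 1 - alpha_f s * beta s / alpha_m s * l * (h\<^sup>2 * geometric_factor s l h n))"
    by (intro uniform_bigo_diff uniform_bigo_bounded uniform_bigo_const Suc
        uniform_bigo_weaken[OF uniform_bigo_power[of _ 2]]) simp
  then show ?case by (simp add: geometric_factor_Suc algebra_simps)
qed

lemma geometric_factor_near_1:
  assumes "n \<ge> 1"
  shows "uniform_bigo T 2 (\<lambda>t h. geometric_factor s l h n - 1)"
proof -
  obtain m where n: "n = Suc m" using assms by (cases n) auto
  have "uniform_bigo T 2 (\<lambda>t h. - (alpha_f s * beta s / alpha_m s * l) * (geometric_factor s l h m * h\<^sup>2))"
    by (intro uniform_bigo_bounded uniform_bigo_const geometric_factor_bounded uniform_bigo_power)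
  then show ?thesis by (simp add: n geometric_factor_Suc algebra_simps)
qed

lemma load_weight_bounded: "uniform_bigo T 0 (\<lambda>t h. load_weight s l h)"
  using uniform_bigo_bounded[OF uniform_bigo_const geometric_factor_bounded, of T "1 / alpha_m s"]
  by (simp add: load_weight_def)

lemma predictor_weight_bounded: "uniform_bigo T 0 (\<lambda>t h. predictor_weight s l h)"
  using uniform_bigo_bounded[OF uniform_bigo_const geometric_factor_bounded, of T "1 / alpha_m s"]
  by (cases "upd_form s") (simp_all add: predictor_weight_def)

lemma load_weight_near_limit:
  assumes "num_terms s \<ge> 1"
  shows "uniform_bigo T 2 (\<lambda>t h. load_weight s l h - 1 / alpha_m s)"
  using uniform_bigo_bounded[OF uniform_bigo_const geometric_factor_near_1[OF assms], of T "1 / alpha_m s"]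
  by (simp add: load_weight_def diff_divide_distrib)

text \<open>
  In the displacement form both series start with 1 as soon as they are nonempty, and the next term
  is of order $h^2$. With $N = 1$ the shorter one is empty and the weights differ already in the
  limit, which only $\alpha_f = 0$ can compensate.
\<close>
lemma weights_agree:
  assumes "num_terms s \<ge> 1"
    and "upd_form s = Displacement \<Longrightarrow> num_terms s \<ge> 2 \<or> alpha_f s = 0"
  shows "uniform_bigo T 2 (\<lambda>t h. alpha_f s * (predictor_weight s l h - load_weight s l h))"
proof (cases "upd_form s = Displacement \<and> alpha_f s \<noteq> 0")
  case True
  then have "num_terms s - 1 \<ge> 1" using assms(2) by auto
  then have "uniform_bigo T 2 (\<lambda>t h. alpha_f s * (1 / alpha_m s *
      ((geometric_factor s l h (num_terms s - 1) - 1) - (geometric_factor s l h (num_terms s) - 1))))"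
    using assms(1)
    by (intro uniform_bigo_bounded uniform_bigo_const uniform_bigo_diff geometric_factor_near_1)
  then show ?thesis using True
    by (simp add: predictor_weight_def load_weight_def diff_divide_distrib)
next
  case False
  then have zero: "(\<lambda>t h. alpha_f s * (predictor_weight s l h - load_weight s l h)) = (\<lambda>t h. 0 :: real)"
    by (cases "upd_form s") (auto simp: predictor_weight_def load_weight_def)
  show ?thesis unfolding zero by (rule uniform_bigoI[of _ _ 0]) simp
qed

text \<open>
  The exact solution is inserted into the forced recurrence with the load replaced by
  $y'' + \lambda y$. Taylor polynomials of degree 3 for the displacements and of degree 1 for the
  loads, which carry a factor $h^2$, leave remainders of order $h^4$; the choice of $\gamma$ takes care
  of the polynomial part.
\<close>
lemma modal_truncation:
  fixes y :: "nat \<Rightarrow> real \<Rightarrow> real" and l :: real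
  assumes deriv: "\<And>m t. m < 4 \<Longrightarrow> (y m has_real_derivative y (Suc m) t) (at t)"
    and cont: "continuous_on UNIV (y 4)"
    and N: "num_terms s \<ge> 1" and am: "alpha_m s \<noteq> 0"
    and form: "upd_form s = Displacement \<Longrightarrow> num_terms s \<ge> 2 \<or> alpha_f s = 0"
    and gam: "gamma s = 1/2 - alpha_f s + alpha_m s"
  defines "\<phi> \<equiv> \<lambda>t h k. y 2 (t + real k * h + alpha_f s * h) + l * y 0 (t + real k * h + alpha_f s * h)"
  shows "uniform_bigo T 4 (\<lambda>t h. three_step (modal_matrix s l h) (\<lambda>k. y 0 (t + real k * h)) -
     load_weight s l h * h\<^sup>2 * (beta s * (\<phi> t h 2 - 2 * \<phi> t h 1 + \<phi> t h 0)
       + (gamma s + 1/2) * (\<phi> t h 1 - \<phi> t h 0) + \<phi> t h 0))"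
proof -
  define p where "p = load_weight s l"
  define q where "q = predictor_weight s l"
  define A where "A h = p h * beta s + alpha_f s * q h * (gamma s + 1/2)" for h
  define B where "B h = p h * (gamma s + 1/2) + alpha_f s * q h" for h
  \<comment> \<open>The Taylor remainders of the displacement and of the load at the offset \<open>\<theta> * h\<close>.\<close>
  define \<rho> where "\<rho> \<theta> t h = y 0 (t + \<theta> * h) - (y 0 t + y 1 t * (\<theta> * h) + y 2 t / 2 * (\<theta> * h)\<^sup>2
       + y 3 t / 6 * (\<theta> * h) ^ 3)" for \<theta> t h
  define \<sigma> where "\<sigma> \<theta> t h = y 2 (t + \<theta> * h) - (y 2 t + y 3 t * (\<theta> * h))
       + l * (y 0 (t + \<theta> * h) - (y 0 t + y 1 t * (\<theta> * h)))" for \<theta> t h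
  have cont_y: "continuous_on UNIV (y m)" if "m < 4" for m
    using deriv[OF that] by (meson DERIV_isCont continuous_at_imp_continuous_on)
  have \<rho>: "uniform_bigo T 4 (\<lambda>t h. \<rho> \<theta> t h)" for \<theta>
    using uniform_taylor_remainder[OF deriv cont, of T \<theta>]
    by (simp add: \<rho>_def eval_nat_numeral)
  have \<sigma>: "uniform_bigo T 2 (\<lambda>t h. \<sigma> \<theta> t h)" for \<theta>
  proof -
    have "uniform_bigo T 2 (\<lambda>t h. y 2 (t + \<theta> * h) - (y 2 t + y 3 t * (\<theta> * h)))"
      using uniform_taylor_remainder[of 2 "\<lambda>m. y (m + 2)" T \<theta>] deriv cont
      by (simp add: eval_nat_numeral)
    moreover have "uniform_bigo T 2 (\<lambda>t h. y 0 (t + \<theta> * h) - (y 0 t + y 1 t * (\<theta> * h)))"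
      using uniform_taylor_remainder[of 2 y T \<theta>] deriv cont_y[of 2]
      by (simp add: eval_nat_numeral)
    ultimately show ?thesis
      unfolding \<sigma>_def by (intro uniform_bigo_add uniform_bigo_bounded uniform_bigo_const)
  qed
  have p: "uniform_bigo T 0 (\<lambda>t h. p h)" unfolding p_def by (rule load_weight_bounded)
  have q: "uniform_bigo T 0 (\<lambda>t h. q h)" unfolding q_def by (rule predictor_weight_bounded)
  have A: "uniform_bigo T 0 (\<lambda>t h. A h)" and B: "uniform_bigo T 0 (\<lambda>t h. B h)"
    unfolding A_def B_def
    by (intro uniform_bigo_add uniform_bigo_bounded p q uniform_bigo_const)+
  have y: "uniform_bigo T 0 (\<lambda>t h. y m t)" if "m < 4" for m
    by (rule uniform_bigo_continuous[OF cont_y[OF that]])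
  have h: "uniform_bigo T k (\<lambda>t h. h ^ j)" if "k \<le> j" for k j
    by (rule uniform_bigo_weaken[OF uniform_bigo_power that])
  have E1: "uniform_bigo T 4 (\<lambda>t h. \<rho> 3 t h - 3 * \<rho> 2 t h + 3 * \<rho> 1 t h
        + (p h + l * h\<^sup>2 * A h) * (\<rho> 2 t h - 2 * \<rho> 1 t h) + l * h\<^sup>2 * B h * \<rho> 1 t h)"
    by (intro uniform_bigo_add uniform_bigo_diff uniform_bigo_bounded \<rho> p A B uniform_bigo_const h) simp_all
  \<comment> \<open>The load remainders are of order 2 only, but the loads carry a factor \<open>h\<^sup>2\<close>.\<close>
  have "uniform_bigo T (2 + 2) (\<lambda>t h. h\<^sup>2 * (p h * (beta s * (\<sigma> (2 + alpha_f s) t h - 2 * \<sigma> (1 + alpha_f s) t h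
        + \<sigma> (alpha_f s) t h) + (gamma s + 1/2) * (\<sigma> (1 + alpha_f s) t h - \<sigma> (alpha_f s) t h) + \<sigma> (alpha_f s) t h)))"
    by (intro uniform_bigo_mult[OF uniform_bigo_power])
      (intro uniform_bigo_add uniform_bigo_diff uniform_bigo_bounded p \<sigma> uniform_bigo_const)
  then have E2: "uniform_bigo T 4 (\<lambda>t h. h\<^sup>2 * (p h * (beta s * (\<sigma> (2 + alpha_f s) t h - 2 * \<sigma> (1 + alpha_f s) t h
        + \<sigma> (alpha_f s) t h) + (gamma s + 1/2) * (\<sigma> (1 + alpha_f s) t h - \<sigma> (alpha_f s) t h) + \<sigma> (alpha_f s) t h)))"
    by simp
  \<comment> \<open>The parts of the second and first difference that the factor \<open>l * h\<^sup>2\<close> lifts to order 4.\<close>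
  have E3: "uniform_bigo T 4 (\<lambda>t h. l * (A h * (y 2 t * h ^ 4 + y 3 t * h ^ 5)
        + B h * (y 2 t / 2 * h ^ 4 + y 3 t / 6 * h ^ 5)))"
    using y[of 2] y[of 3] uniform_bigo_bounded[OF uniform_bigo_const y, of 2 "1/2"]
      uniform_bigo_bounded[OF uniform_bigo_const y, of 3 "1/6"]
    by (intro uniform_bigo_add uniform_bigo_bounded A B uniform_bigo_const h) simp_all
  \<comment> \<open>The critical terms with $h^3$: the smallness of the weight differences supplies a factor $h^2$.\<close>
  have "uniform_bigo T (2 + 2) (\<lambda>t h. alpha_f s * (q h - p h) * (l * y 1 t * h ^ 3)
        - (p h - 1 / alpha_m s) * (alpha_m s * y 3 t * h ^ 3))"
    unfolding p_def q_def
    using form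
    by (intro uniform_bigo_diff[OF uniform_bigo_mult uniform_bigo_mult] weights_agree N
        load_weight_near_limit uniform_bigo_bounded[OF uniform_bigo_bounded]
        uniform_bigo_const y h) simp_all
  then have E4: "uniform_bigo T 4 (\<lambda>t h. alpha_f s * (q h - p h) * (l * y 1 t * h ^ 3)
        - (p h - 1 / alpha_m s) * (alpha_m s * y 3 t * h ^ 3))" by simp
  \<comment> \<open>With the prescribed \<open>gamma s\<close>, the coefficient of \<open>y 3 t * h ^ 3\<close> is $1 - p \alpha_m$, and all
      lower powers of \<open>h\<close> cancel.\<close>
  have expand: "three_step (modal_matrix s l h) (\<lambda>k. y 0 (t + real k * h)) -
     load_weight s l h * h\<^sup>2 * (beta s * (\<phi> t h 2 - 2 * \<phi> t h 1 + \<phi> t h 0)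
       + (gamma s + 1/2) * (\<phi> t h 1 - \<phi> t h 0) + \<phi> t h 0)
     = (\<rho> 3 t h - 3 * \<rho> 2 t h + 3 * \<rho> 1 t h
        + (p h + l * h\<^sup>2 * A h) * (\<rho> 2 t h - 2 * \<rho> 1 t h) + l * h\<^sup>2 * B h * \<rho> 1 t h)
       - h\<^sup>2 * (p h * (beta s * (\<sigma> (2 + alpha_f s) t h - 2 * \<sigma> (1 + alpha_f s) t h
        + \<sigma> (alpha_f s) t h) + (gamma s + 1/2) * (\<sigma> (1 + alpha_f s) t h - \<sigma> (alpha_f s) t h) + \<sigma> (alpha_f s) t h))
       + l * (A h * (y 2 t * h ^ 4 + y 3 t * h ^ 5)
        + B h * (y 2 t / 2 * h ^ 4 + y 3 t / 6 * h ^ 5))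
       + (alpha_f s * (q h - p h) * (l * y 1 t * h ^ 3)
        - (p h - 1 / alpha_m s) * (alpha_m s * y 3 t * h ^ 3))" for t h
  proof -
    have y0: "y 0 (t + \<theta> * h) = y 0 t + y 1 t * (\<theta> * h) + y 2 t / 2 * (\<theta> * h)\<^sup>2
       + y 3 t / 6 * (\<theta> * h) ^ 3 + \<rho> \<theta> t h" for \<theta> by (simp add: \<rho>_def)
    have \<phi>: "\<phi> t h k = y 2 t + y 3 t * ((real k + alpha_f s) * h)
       + l * (y 0 t + y 1 t * ((real k + alpha_f s) * h)) + \<sigma> (real k + alpha_f s) t h" for k
      by (simp add: \<phi>_def \<sigma>_def algebra_simps)
    have \<rho>0: "\<rho> 0 t h = 0" by (simp add: \<rho>_def)
    show ?thesis
      unfolding three_step_differences y0 \<phi> A_def B_def p_def[symmetric] q_def[symmetric] gam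
      using am \<rho>0
      by (simp add: field_simps power2_eq_square power3_eq_cube eval_nat_numeral)
  qed
  show ?thesis unfolding expand
    by (intro uniform_bigo_add uniform_bigo_diff E1 E2 E3 E4)
qed

text \<open>
  The three-step operator is linear, so the operator applied to the error is its value on the exact
  solution minus its value on the numerical one. The latter depends on the loads alone, and the
  modal equation expresses these through the exact solution.
\<close>
lemma mode_error_bound:
  fixes M K Q :: "real^'n^'n"
  assumes M: "invertible M" and spec: "spectral_decomposition (matrix_inv M ** K) Q \<omega>"
    and N: "num_terms s \<ge> 1" and am: "alpha_m s \<noteq> 0"
    and b: "upd_form s = Displacement \<Longrightarrow> beta s \<noteq> 0"
    and form: "upd_form s = Displacement \<Longrightarrow> num_terms s \<ge> 2 \<or> alpha_f s = 0"
    and gam: "gamma s = 1/2 - alpha_f s + alpha_m s"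
    and sol: "semidiscrete_solution 4 M K F D"
  obtains C where "C > 0" and
    "\<And>t h X. 0 \<le> t \<Longrightarrow> t \<le> T \<Longrightarrow> 0 < h \<Longrightarrow> h < 1 \<Longrightarrow>
       (\<And>k. k < 3 \<Longrightarrow> gen_alpha_step s M K h (F (t + real k * h + alpha_f s * h)) (X k) (X (Suc k))) \<Longrightarrow>
       \<bar>three_step (modal_matrix s ((\<omega> i)\<^sup>2) h) (\<lambda>k. modal_coord Q i (D 0 (t + real k * h) - fst (X k)))\<bar>
         \<le> C * h ^ 4"
proof -
  define y where "y m t = modal_coord Q i (D m t)" for m t
  define l where "l = (\<omega> i)\<^sup>2"
  define \<phi> where "\<phi> t h k = y 2 (t + real k * h + alpha_f s * h) + l * y 0 (t + real k * h + alpha_f s * h)"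
    for t h k
  interpret bounded_linear "modal_coord Q i"
    using linear_modal_coord by (rule linear_conv_bounded_linear[THEN iffD1])
  have deriv: "(y m has_real_derivative y (Suc m) t) (at t)" if "m < 4" for m t
    using sol that has_vector_derivative unfolding semidiscrete_solution_def y_def
      has_real_derivative_iff_has_vector_derivative by blast
  have cont: "continuous_on UNIV (y 4)"
    using sol continuous_on unfolding semidiscrete_solution_def y_def by blast
  have load: "modal_coord Q i (matrix_inv M *v F t) = y 2 t + l * y 0 t" for t
  proof -
    have "F t = M *v D 2 t + K *v D 0 t" using sol by (simp add: semidiscrete_solution_def)
    then have "matrix_inv M *v F t = D 2 t + (matrix_inv M ** K) *v D 0 t"
      by (simp add: matrix_vector_right_distrib matrix_vector_mul_assoc matrix_inv_inverse[OF M])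
    then show ?thesis by (simp add: modal_coord_simps modal_coord_eigen[OF spec] y_def l_def)
  qed
  obtain C where "C > 0" and
    C: "\<And>t h. 0 \<le> t \<Longrightarrow> t \<le> T \<Longrightarrow> 0 < h \<Longrightarrow> h < 1 \<Longrightarrow>
      \<bar>three_step (modal_matrix s l h) (\<lambda>k. y 0 (t + real k * h)) -
        load_weight s l h * h\<^sup>2 * (beta s * (\<phi> t h 2 - 2 * \<phi> t h 1 + \<phi> t h 0)
          + (gamma s + 1/2) * (\<phi> t h 1 - \<phi> t h 0) + \<phi> t h 0)\<bar> \<le> C * h ^ 4"
    using uniform_bigoE[OF modal_truncation[OF deriv cont N am form gam, of T l]] unfolding \<phi>_def by blast
  show ?thesis
  proof (rule that[OF \<open>C > 0\<close>])
    fix t h :: real and X :: "nat \<Rightarrow> 'n state"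
    assume t: "0 \<le> t" "t \<le> T" and h: "0 < h" "h < 1"
      and step: "\<And>k. k < 3 \<Longrightarrow> gen_alpha_step s M K h (F (t + real k * h + alpha_f s * h)) (X k) (X (Suc k))"
    define u v a where "u k = modal_coord Q i (fst (X k))" and "v k = modal_coord Q i (fst (snd (X k)))"
      and "a k = modal_coord Q i (snd (snd (X k)))" for k
    have state: "modal_state Q i (X k) = (u k, v k, a k)" for k
      by (cases "X k") (simp add: u_def v_def a_def)
    have "(u (Suc k), v (Suc k), a (Suc k)) = modal_step s l h (\<phi> t h k) (u k, v k, a k)" if "k < 3" for k
    proof -
      have "modal_state Q i (X (Suc k)) = modal_step s l h
          (modal_coord Q i (matrix_inv M *v F (t + real k * h + alpha_f s * h))) (modal_state Q i (X k))"
        using gen_alpha_step_iff_modal[OF M spec N am b h(1)] step[OF that] unfolding l_def by blast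
      then show ?thesis by (simp only: state load \<phi>_def)
    qed
    from three_step_forced[where u = u and v = v and a = a and \<phi> = "\<phi> t h", OF this] C[OF t h]
    have "\<bar>three_step (modal_matrix s l h) (\<lambda>k. y 0 (t + real k * h)) - three_step (modal_matrix s l h) u\<bar>
        \<le> C * h ^ 4" by simp
    then show "\<bar>three_step (modal_matrix s ((\<omega> i)\<^sup>2) h)
        (\<lambda>k. modal_coord Q i (D 0 (t + real k * h) - fst (X k)))\<bar> \<le> C * h ^ 4"
      by (simp add: modal_coord_simps three_step_diff y_def[symmetric] u_def[symmetric] l_def[symmetric])
  qed
qed

section \<open>Second-order accuracy\<close>

theorem theorem1:
  fixes s :: gen_alpha
    and M K Q :: "real^'n^'n"
    and \<omega> :: "'n \<Rightarrow> real"
  assumes "invertible M"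
    and "spectral_decomposition (matrix_inv M ** K) Q \<omega>"
    and "num_terms s \<ge> 1"
    and "alpha_m s \<noteq> 0"
    and "upd_form s = Displacement \<Longrightarrow> beta s \<noteq> 0"
    and "upd_form s = Displacement \<Longrightarrow> num_terms s \<ge> 2 \<or> alpha_f s = 0"
    and "gamma s = 1/2 - alpha_f s + alpha_m s"
  shows "time_accurate 2 s M K Q"
  unfolding time_accurate_def
proof (intro conjI allI impI)
  fix h :: real and f X assume "h > 0"
  then show "\<exists>!Y. gen_alpha_step s M K h f X Y"
    using gen_alpha_step_unique assms(1-5) by blast
next
  fix F D and T :: real
  assume "semidiscrete_solution (2 + 2) M K F D"
  then have sol: "semidiscrete_solution 4 M K F D" by simp
  define bound where "bound i C \<longleftrightarrow> C > 0 \<and> (\<forall>t h X. 0 \<le> t \<and> t \<le> T \<and> 0 < h \<and> h < 1 \<and>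
       (\<forall>k<3. gen_alpha_step s M K h (F (t + real k * h + alpha_f s * h)) (X k) (X (Suc k))) \<longrightarrow>
       \<bar>three_step (modal_matrix s ((\<omega> i)\<^sup>2) h) (\<lambda>k. modal_coord Q i (D 0 (t + real k * h) - fst (X k)))\<bar>
         \<le> C * h ^ 4)" for i C
  have "\<exists>C. bound i C" for i
    unfolding bound_def by (rule mode_error_bound[OF assms sol, of T i]) blast+
  then obtain C where C: "\<And>i. bound i (C i)" by metis
  \<comment> \<open>There are finitely many modes, so the sum of their constants serves all of them.\<close>
  show "\<exists>C h. h > 0 \<and>
         (\<forall>i. \<forall>\<Delta>t. 0 < \<Delta>t \<and> \<Delta>t < h \<longrightarrow>
           (\<exists>G. amplification_matrix s M K \<Delta>t (column i Q) G \<and>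
             (\<forall>t X. 0 \<le> t \<and> t \<le> T \<and>
               (\<forall>k<3. gen_alpha_step s M K \<Delta>t (F (t + real k * \<Delta>t + alpha_f s * \<Delta>t))
                         (X k) (X (Suc k))) \<longrightarrow>
               \<bar>three_step G (\<lambda>k. modal_coord Q i (D 0 (t + real k * \<Delta>t) - fst (X k)))
                  / \<Delta>t\<^sup>2\<bar> \<le> C * \<Delta>t ^ 2)))"
  proof (rule exI[of _ "\<Sum>i\<in>UNIV. C i"], rule exI[of _ 1], intro conjI allI impI)
    fix i h assume "0 < h \<and> h < (1::real)"
    then have h: "0 < h" "h < 1" by auto
    show "\<exists>G. amplification_matrix s M K h (column i Q) G \<and>
             (\<forall>t X. 0 \<le> t \<and> t \<le> T \<and>
               (\<forall>k<3. gen_alpha_step s M K h (F (t + real k * h + alpha_f s * h))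
                         (X k) (X (Suc k))) \<longrightarrow>
               \<bar>three_step G (\<lambda>k. modal_coord Q i (D 0 (t + real k * h) - fst (X k)))
                  / h\<^sup>2\<bar> \<le> (\<Sum>i\<in>UNIV. C i) * h ^ 2)"
    proof (intro exI[of _ "modal_matrix s ((\<omega> i)\<^sup>2) h"] conjI allI impI)
      show "amplification_matrix s M K h (column i Q) (modal_matrix s ((\<omega> i)\<^sup>2) h)"
        using modal_matrix_is_amplification[OF assms(1-5) h(1)] .
    next
      fix t and X :: "nat \<Rightarrow> 'n state"
      let ?e = "three_step (modal_matrix s ((\<omega> i)\<^sup>2) h)
          (\<lambda>k. modal_coord Q i (D 0 (t + real k * h) - fst (X k)))"
      assume "0 \<le> t \<and> t \<le> T \<and> (\<forall>k<3. gen_alpha_step s M K h (F (t + real k * h + alpha_f s * h))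
                         (X k) (X (Suc k)))"
      then have "\<bar>?e\<bar> \<le> C i * h ^ 4"
        using C[of i] h unfolding bound_def by blast
      also have "\<dots> \<le> (\<Sum>i\<in>UNIV. C i) * h ^ 4"
        using h C unfolding bound_def
        by (intro mult_right_mono member_le_sum) (auto intro: less_imp_le)
      finally have "\<bar>?e\<bar> \<le> (\<Sum>i\<in>UNIV. C i) * h ^ 4" .
      then have "\<bar>?e\<bar> \<le> (\<Sum>i\<in>UNIV. C i) * h ^ 2 * h\<^sup>2"
        by (simp add: power2_eq_square eval_nat_numeral mult.assoc)
      then show "\<bar>?e / h\<^sup>2\<bar> \<le> (\<Sum>i\<in>UNIV. C i) * h ^ 2"
        using h by (simp add: abs_divide pos_divide_le_eq)
    qed
  qed simp
qed

end
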